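(* Let $R=\{(0,0),(0,1),(0,2),(3,0),(1,2),(1,3),(2,2),(3,2),(3,3)\}$ and $R'=\{(0,0),(1,0),(2,0),(0,3),(2,1),(2,2),(2,3),(3,1),(3,3)\}$. Then $(123,R)\sim_{jd}(132,R)$ and $(123,R')\sim_{jd}(132,R')$.
   Context: $S_n$ is the set of permutations $\pi=\pi_1\cdots\pi_n$ of $\{1,\dots,n\}$. A mesh pattern of length $k$ is a pair $(\tau,R)$ with $\tau\in S_k$ and $R\subseteq\{0,\dots,k\}\times\{0,\dots,k\}$ (the set of shaded boxes; box $(a,b)$ is the unit square with lower-left corner $(a,b)$). An occurrence of $(\tau,R)$ in $\pi\in S_n$ is a subsequence $\pi_{i_1}\cdots\pi_{i_k}$, $i_1<\dots<i_k$, order-isomorphic to $\tau$, such that, with $i_0=0$, $i_{k+1}=n+1$, with $v_1<\dots<v_k$ the values $\pi_{i_1},\dots,\pi_{i_k}$ in increasing order, and $v_0=0$, $v_{k+1}=n+1$, for each $(a,b)\in R$ there is no index $m$ with $i_a<m<i_{a+1}$ and $v_b<\pi_m<v_{b+1}$. Two mesh patterns $q_1,q_2$ are jointly equidistributed, written $q_1\sim_{jd}q_2$, if for all nonnegative integers $n,k,\ell$ the number of $\pi\in S_n$ with exactly $k$ occurrences of $q_1$ and $\ell$ occurrences of $q_2$ equals the number of $\pi\in S_n$ with exactly $\ell$ occurrences of $q_1$ and $k$ occurrences of $q_2$. *)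

theory Defs
  imports "HOL-Combinatorics.Permutations"
begin

definition Sym :: "nat \<Rightarrow> (nat \<Rightarrow> nat) set" where
  "Sym n = {\<pi>. \<pi> permutes {1..n}}"

definition one_line :: "nat list \<Rightarrow> nat \<Rightarrow> nat" where
  "one_line w i = (if 1 \<le> i \<and> i \<le> length w then w ! (i - 1) else i)"

text \<open>A triple \<open>(k, \<tau>, R)\<close> stands for the mesh pattern \<open>(\<tau>, R)\<close> of length \<open>k\<close>. The length is
  carried explicitly because it cannot be read off from the function \<open>\<tau>\<close>.\<close>

type_synonym mesh_pattern = "nat \<times> (nat \<Rightarrow> nat) \<times> (nat \<times> nat) set"

definition is_mesh_pattern :: "mesh_pattern \<Rightarrow> bool" where
  "is_mesh_pattern = (\<lambda>(k, \<tau>, R). \<tau> \<in> Sym k \<and> R \<subseteq> {0..k} \<times> {0..k})"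

text \<open>The elements of \<open>A\<close> in increasing order, at positions \<open>1, \<dots>, card A\<close>, between the sentinels
  \<open>0\<close> at position \<open>0\<close> and \<open>n + 1\<close> at position \<open>card A + 1\<close>.\<close>

definition bordered :: "nat \<Rightarrow> nat set \<Rightarrow> nat \<Rightarrow> nat" where
  "bordered n A j = (0 # sorted_list_of_set A @ [n + 1]) ! j"

text \<open>A subsequence \<open>\<pi>\<^sub>i\<^sub>1 \<dots> \<pi>\<^sub>i\<^sub>k\<close> is represented by its set \<open>I = {i\<^sub>1 < \<dots> < i\<^sub>k}\<close> of positions, so that
  counting occurrences is counting sets.\<close>

definition is_occurrence :: "nat \<Rightarrow> (nat \<Rightarrow> nat) \<Rightarrow> mesh_pattern \<Rightarrow> nat set \<Rightarrow> bool" where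
  "is_occurrence n \<pi> = (\<lambda>(k, \<tau>, R) I.
     I \<subseteq> {1..n} \<and> card I = k \<and>
     (let i = bordered n I; v = bordered n (\<pi> ` I) in
        (\<forall>a\<in>{1..k}. \<forall>b\<in>{1..k}. \<pi> (i a) < \<pi> (i b) \<longleftrightarrow> \<tau> a < \<tau> b) \<and>
        (\<forall>(a, b)\<in>R. \<not> (\<exists>m\<in>{1..n}. i a < m \<and> m < i (a + 1) \<and> v b < \<pi> m \<and> \<pi> m < v (b + 1)))))"

definition occurrences :: "mesh_pattern \<Rightarrow> nat \<Rightarrow> (nat \<Rightarrow> nat) \<Rightarrow> nat" where
  "occurrences q n \<pi> = card {I. is_occurrence n \<pi> q I}"

definition jointly_equidistributed :: "mesh_pattern \<Rightarrow> mesh_pattern \<Rightarrow> bool"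
  (infix "\<sim>\<^sub>j\<^sub>d" 50) where
  "q1 \<sim>\<^sub>j\<^sub>d q2 \<longleftrightarrow> (\<forall>n k l.
     card {\<pi> \<in> Sym n. occurrences q1 n \<pi> = k \<and> occurrences q2 n \<pi> = l} =
     card {\<pi> \<in> Sym n. occurrences q1 n \<pi> = l \<and> occurrences q2 n \<pi> = k})"

definition shading_R :: "(nat \<times> nat) set" where
  "shading_R = {(0,0),(0,1),(0,2),(3,0),(1,2),(1,3),(2,2),(3,2),(3,3)}"

definition shading_R' :: "(nat \<times> nat) set" where
  "shading_R' = {(0,0),(1,0),(2,0),(0,3),(2,1),(2,2),(2,3),(3,1),(3,3)}"

lemma one_line_123: "one_line [1,2,3] = id"
  by (rule ext) (auto simp: one_line_def nth_Cons' split: if_splits)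

lemma one_line_132: "one_line [1,3,2] = transpose 2 3"
  by (rule ext) (auto simp: one_line_def nth_Cons' transpose_def split: if_splits)

lemma is_mesh_pattern_shadings:
  assumes "R \<in> {shading_R, shading_R'}"
  shows "is_mesh_pattern (3, one_line [1,2,3], R)" "is_mesh_pattern (3, one_line [1,3,2], R)"
  unfolding is_mesh_pattern_def one_line_123 one_line_132
  using assms
  by (auto simp: Sym_def shading_R_def shading_R'_def permutes_id intro!: permutes_swap_id)

end

theory Submission
  imports Defs
begin

text \<open>The second shading is the transpose of the first, and both permutations \<open>123\<close>, \<open>132\<close> are
  involutions, so \<open>\<pi> \<mapsto> \<pi>\<^sup>-\<^sup>1\<close> reduces everything to \<open>R'\<close>. An occurrence for \<open>R'\<close> sits at positions
  \<open>i, v, v + 1\<close>, and \<open>i\<close> is the same for all occurrences of both patterns in \<open>\<pi>\<close>. For fixed \<open>i\<close>,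
  the candidate positions \<open>v\<close> form an interval behind \<open>i\<close>; label \<open>v\<close> by \<open>Lo\<close> if \<open>\<pi> v\<close> is the smallest
  value above \<open>\<pi> i\<close> from \<open>v\<close> on, and by \<open>Hi\<close> if all larger values lie strictly between \<open>i\<close> and \<open>v\<close>.
  Then occurrences of \<open>123\<close> are factors \<open>Lo Hi\<close> and occurrences of \<open>132\<close> are factors \<open>Hi Lo\<close> of
  the label word. Swapping the values at \<open>v\<close> and \<open>v + 1\<close> exchanges such a pair of labels and changes
  no other, so the number of permutations with a given word is unchanged when letters are permuted
  within a maximal factor over \<open>Lo\<close>, \<open>Hi\<close>; reversing all these factors exchanges the two counts.

  Only the last position may carry both labels. Such a permutation is counted with both words
  \<open>y Lo\<close> and \<open>y Hi\<close>: one of them has the right pair of counts, the other the counts of \<open>y\<close>, and the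
  surplus is again symmetric by the same argument applied to the words \<open>y\<close>.\<close>

section \<open>Words\<close>

datatype letter = Lo | Hi | No

fun adj :: "letter \<Rightarrow> letter \<Rightarrow> letter list \<Rightarrow> nat" where
  "adj a b (x # y # xs) = of_bool (x = a \<and> y = b) + adj a b (y # xs)"
| "adj a b xs = 0"

lemma adj_append_Cons:
  "adj a b (xs @ y # ys) = adj a b (xs @ [y]) + adj a b (y # ys)"
  by (induction a b xs rule: adj.induct) auto

lemma adj_snoc2: "adj a b (xs @ [y, z]) = adj a b (xs @ [y]) + of_bool (y = a \<and> z = b)"
  using adj_append_Cons[of a b xs y "[z]"] by simp

lemma adj_snoc_other:
  assumes "y \<noteq> b"
  shows "adj a b (xs @ [y]) = adj a b xs"
  using assms by (cases xs rule: rev_cases) (simp_all add: adj_snoc2)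

lemma adj_Cons_other:
  assumes "y \<noteq> a"
  shows "adj a b (y # xs) = adj a b xs"
  using assms by (cases xs) simp_all

lemma adj_rev: "adj a b (rev xs) = adj b a xs"
proof (induction b a xs rule: adj.induct)
  case (1 b a x y xs)
  then show ?case using adj_append_Cons[of a b "rev xs" y "[x]"] by auto
qed auto

text \<open>No counted pair can contain the separating \<open>No\<close>, so the two sides
  contribute independently.\<close>

lemma adj_split_No:
  assumes "a \<noteq> No" "b \<noteq> No"
  shows "adj a b (xs @ No # ys) = adj a b xs + adj a b ys"
  using assms
  by (subst adj_append_Cons) (simp add: adj_snoc_other adj_Cons_other)

lemma adj_conv_card:
  "adj a b xs = card {j. Suc j < length xs \<and> xs ! j = a \<and> xs ! Suc j = b}"
proof (induction a b xs rule: adj.induct)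
  case (1 a b x y xs)
  let ?A = "{j. Suc j < length (y # xs) \<and> (y # xs) ! j = a \<and> (y # xs) ! Suc j = b}"
  have "{j. Suc j < length (x # y # xs) \<and> (x # y # xs) ! j = a \<and> (x # y # xs) ! Suc j = b}
    = {j. j = 0 \<and> x = a \<and> y = b} \<union> Suc ` ?A" (is "?B = _")
  proof -
    have "j \<in> ?B \<longleftrightarrow> j \<in> {j. j = 0 \<and> x = a \<and> y = b} \<union> Suc ` ?A" for j
      by (cases j) auto
    then show ?thesis by blast
  qed
  moreover have "card ({j. j = 0 \<and> x = a \<and> y = b} \<union> Suc ` ?A)
    = card {j::nat. j = 0 \<and> x = a \<and> y = b} + card (Suc ` ?A)"
    by (rule card_Un_disjoint) (auto intro: finite_subset[of _ "{..length xs}"])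
  moreover have "card {j::nat. j = 0 \<and> x = a \<and> y = b} = of_bool (x = a \<and> y = b)"
    by auto
  ultimately show ?case using 1 by (simp add: card_image)
qed auto

text \<open>\<open>rev_factors []\<close> reverses every maximal factor without \<open>No\<close>; the first argument accumulates
  the reversal of the current factor.\<close>

fun rev_factors :: "letter list \<Rightarrow> letter list \<Rightarrow> letter list" where
  "rev_factors acc [] = acc"
| "rev_factors acc (x # xs) =
     (if x = No then acc @ No # rev_factors [] xs else rev_factors (x # acc) xs)"

lemma length_rev_factors [simp]: "length (rev_factors acc xs) = length acc + length xs"
  by (induction acc xs rule: rev_factors.induct) auto

text \<open>Reversal exchanges \<open>a b\<close> with \<open>b a\<close> inside each factor, and
  the separators \<open>No\<close> keep pairs from crossing between factors. On the right,
  \<open>rev acc\<close> restores the part of the current factor already read.\<close>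

lemma adj_rev_factors:
  assumes "a \<noteq> No" "b \<noteq> No"
  shows "adj a b (rev_factors acc xs) = adj b a (rev acc @ xs)"
  using assms
proof (induction acc xs rule: rev_factors.induct)
  case (1 acc)
  then show ?case by (simp add: adj_rev)
next
  case (2 acc x xs)
  then show ?case
    by (cases "x = No") (simp_all add: adj_split_No adj_rev)
qed

lemma rev_factors_append:
  assumes "No \<notin> set ys"
  shows "rev_factors acc (ys @ zs) = rev_factors (rev ys @ acc) zs"
  using assms by (induction ys arbitrary: acc) auto

text \<open>With \<open>acc = []\<close> this makes \<open>rev_factors []\<close> an involution; the
  general accumulator serves the induction.\<close>

lemma rev_factors_rev_factors:
  assumes "No \<notin> set acc"
  shows "rev_factors [] (rev_factors acc xs) = rev acc @ xs"
  using assms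
proof (induction acc xs rule: rev_factors.induct)
  case (1 acc)
  then show ?case using rev_factors_append[of acc "[]" "[]"] by simp
next
  case (2 acc x xs)
  then show ?case by (cases "x = No") (simp_all add: rev_factors_append)
qed

section \<open>Symmetric sums over words\<close>

definition words :: "nat \<Rightarrow> nat \<Rightarrow> nat \<Rightarrow> letter list set" where
  "words n k l = {xs. length xs \<le> n \<and> adj Lo Hi xs = k \<and> adj Hi Lo xs = l}"

text \<open>Instantiated below for two counts: permutations fitting a word, and permutations fitting
  both extensions of a word by a final \<open>Lo\<close> or \<open>Hi\<close>.\<close>

locale swap_invariant =
  fixes F :: "letter list \<Rightarrow> nat"
  assumes swap: "F (u @ Lo # Hi # w) = F (u @ Hi # Lo # w)"
begin

text \<open>The letter \<open>x\<close> passes the letters of \<open>p\<close> one at a time: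
  passing a different letter is the assumed exchange, passing an equal one changes nothing.\<close>

lemma move:
  assumes "x \<noteq> No" "No \<notin> set p"
  shows "F (u @ p @ x # w) = F (u @ x # p @ w)"
  using assms
proof (induction p arbitrary: u)
  case (Cons y p)
  have "F (u @ (y # p) @ x # w) = F (u @ y # x # p @ w)"
    using Cons.IH[of "u @ [y]"] Cons.prems by simp
  also have "\<dots> = F (u @ x # y # p @ w)"
    using Cons.prems swap[of u "p @ w"] by (cases x; cases y) auto
  finally show ?case by simp
qed simp

text \<open>The first letter of \<open>y\<close> is found in \<open>y'\<close> and brought to the
  front by \<open>move\<close>; the induction then continues with this letter absorbed into the
  prefix \<open>u\<close>.\<close>

lemma mset_cong:
  assumes "mset y = mset y'" "No \<notin> set y"
  shows "F (u @ y @ w) = F (u @ y' @ w)"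
  using assms
proof (induction y arbitrary: y' u)
  case (Cons x y)
  then have "x \<in> set y'"
    by (metis list.set_intros(1) set_mset_mset)
  then obtain p q where y': "y' = p @ x # q"
    by (auto simp: in_set_conv_decomp)
  have "No \<notin> set y'" "mset y = mset (p @ q)"
    using Cons.prems y' mset_eq_setD[OF Cons.prems(1)] by auto
  then have "F (u @ y' @ w) = F ((u @ [x]) @ (p @ q) @ w)"
    using move[of x p u "q @ w"] y' by force
  also have "\<dots> = F ((u @ [x]) @ y @ w)"
    using Cons.IH[of "p @ q" "u @ [x]"] Cons.prems \<open>mset y = mset (p @ q)\<close> by simp
  finally show ?case by simp
qed simp

lemma rev_factors_cong:
  assumes "No \<notin> set acc"
  shows "F (u @ rev_factors acc xs) = F (u @ rev acc @ xs)"
  using assms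
proof (induction acc xs arbitrary: u rule: rev_factors.induct)
  case (1 acc)
  then show ?case using mset_cong[of acc "rev acc" u "[]"] by simp
next
  case (2 acc x xs)
  show ?case
  proof (cases "x = No")
    case True
    then have "F (u @ rev_factors acc (x # xs)) = F (u @ acc @ No # xs)"
      using "2.IH"(1)[of "u @ acc @ [No]"] by simp
    also have "\<dots> = F (u @ rev acc @ No # xs)"
      using mset_cong[of acc "rev acc" u "No # xs"] "2.prems" by simp
    finally show ?thesis using True by simp
  next
    case False
    then show ?thesis using "2.IH"(2)[of u] "2.prems" by simp
  qed
qed

text \<open>The involution \<open>rev_factors []\<close> preserves length and \<open>F\<close> and
  exchanges the two adjacency counts.\<close>

lemma sum_words_swap: "sum F (words n k l) = sum F (words n l k)"
  by (rule sum.reindex_bij_witness[of _ "rev_factors []" "rev_factors []"])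
     (use rev_factors_rev_factors[of "[]"] rev_factors_cong[of "[]" "[]"] in
       \<open>auto simp: words_def adj_rev_factors\<close>)

end

section \<open>Labels of positions\<close>

text \<open>Encodes the shaded boxes (0,0), (1,0), (2,0): up to the last position of an occurrence
  with first position \<open>i\<close>, no value is below \<pi> i.\<close>

definition window :: "nat \<Rightarrow> nat \<Rightarrow> (nat \<Rightarrow> nat) \<Rightarrow> nat set" where
  "window n i \<pi> = {v. i < v \<and> v \<le> n \<and> (\<forall>m\<in>{1..n}. \<pi> m < \<pi> i \<longrightarrow> v < m)}"

text \<open>For an occurrence whose last two positions are adjacent, \<open>low\<close> at the
  smaller of the two entries there expresses box (3,1), and \<open>high\<close> at the larger one
  expresses boxes (0,3) and (3,3).\<close>

definition low :: "nat \<Rightarrow> nat \<Rightarrow> (nat \<Rightarrow> nat) \<Rightarrow> nat \<Rightarrow> bool" where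
  "low n i \<pi> v \<longleftrightarrow> (\<forall>m\<in>{1..n}. v < m \<longrightarrow> \<not> (\<pi> i < \<pi> m \<and> \<pi> m < \<pi> v))"

definition high :: "nat \<Rightarrow> nat \<Rightarrow> (nat \<Rightarrow> nat) \<Rightarrow> nat \<Rightarrow> bool" where
  "high n i \<pi> v \<longleftrightarrow> (\<forall>m\<in>{1..n}. \<pi> v < \<pi> m \<longrightarrow> i < m \<and> m < v)"

lemma Sym_eq_iff:
  assumes "\<pi> \<in> Sym n"
  shows "\<pi> x = \<pi> y \<longleftrightarrow> x = y"
  using assms permutes_inj by (auto simp: Sym_def inj_def)

lemma finite_Sym [simp]: "finite (Sym n)"
  by (simp add: Sym_def finite_permutations)

lemma Sym_transpose:
  assumes "\<pi> \<in> Sym n" "x \<in> {1..n}" "y \<in> {1..n}"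
  shows "\<pi> \<circ> transpose x y \<in> Sym n"
  using assms unfolding Sym_def by (auto intro!: permutes_compose permutes_swap_id)

lemma window_bounds: "v \<in> window n i \<pi> \<Longrightarrow> i < v \<and> v \<le> n"
  by (simp add: window_def)

lemma window_value:
  assumes "\<pi> \<in> Sym n" "v \<in> window n i \<pi>"
  shows "\<pi> i < \<pi> v"
proof -
  have "v \<in> {1..n}" "v \<noteq> i" "\<not> \<pi> v < \<pi> i"
    using assms(2) by (auto simp: window_def)
  then show ?thesis using Sym_eq_iff[OF assms(1), of v i] by simp
qed

section \<open>Swapping the values at two neighbouring window positions\<close>

context
  fixes n i v :: nat and \<pi> :: "nat \<Rightarrow> nat"
  assumes \<pi>: "\<pi> \<in> Sym n" and v: "v \<in> window n i \<pi>" and Suc_v: "Suc v \<in> window n i \<pi>"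
begin

lemma transpose_at_base: "(\<pi> \<circ> transpose v (Suc v)) i = \<pi> i"
  using v by (simp add: window_def transpose_def)

text \<open>Both moved values exceed \<pi> i, so the values below \<pi> i keep their
  positions.\<close>

lemma window_transpose: "window n i (\<pi> \<circ> transpose v (Suc v)) = window n i \<pi>"
proof -
  have "(\<pi> \<circ> transpose v (Suc v)) m < \<pi> i \<longleftrightarrow> \<pi> m < \<pi> i" for m
    using window_value[OF \<pi> v] window_value[OF \<pi> Suc_v] by (auto simp: transpose_def)
  then show ?thesis using transpose_at_base by (simp add: window_def)
qed

lemma ball_transpose:
  "(\<forall>m\<in>{1..n}. P (transpose v (Suc v) m)) \<longleftrightarrow> (\<forall>m\<in>{1..n}. P m)"
proof -
  have "transpose v (Suc v) ` {1..n} = {1..n}"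
    using window_bounds[OF v] window_bounds[OF Suc_v]
    by (intro permutes_image permutes_swap_id) auto
  then show ?thesis by (metis (no_types, lifting) image_iff)
qed

text \<open>The value at \<open>u\<close> is unchanged, and the positions behind \<open>u\<close>
  are only permuted among themselves.\<close>

lemma low_transpose_other:
  assumes "u \<noteq> v" "u \<noteq> Suc v"
  shows "low n i (\<pi> \<circ> transpose v (Suc v)) u \<longleftrightarrow> low n i \<pi> u"
proof -
  have "u < transpose v (Suc v) m \<longleftrightarrow> u < m" for m
    using assms by (auto simp: transpose_def)
  then show ?thesis
    using ball_transpose[of "\<lambda>m. u < m \<longrightarrow> \<not> (\<pi> i < \<pi> m \<and> \<pi> m < \<pi> u)"] transpose_at_base assms
    by (simp add: low_def)
qed

lemma high_transpose_other:
  assumes "u \<noteq> v" "u \<noteq> Suc v"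
  shows "high n i (\<pi> \<circ> transpose v (Suc v)) u \<longleftrightarrow> high n i \<pi> u"
proof -
  have "i < transpose v (Suc v) m \<and> transpose v (Suc v) m < u \<longleftrightarrow> i < m \<and> m < u" for m
    using assms window_bounds[OF v] by (auto simp: transpose_def)
  then show ?thesis
    using ball_transpose[of "\<lambda>m. \<pi> u < \<pi> m \<longrightarrow> i < m \<and> m < u"] assms
    by (simp add: high_def)
qed

lemma low_imp_less:
  assumes "low n i \<pi> v"
  shows "\<pi> v < \<pi> (Suc v)"
proof -
  have "Suc v \<in> {1..n}" using window_bounds[OF Suc_v] by simp
  then have "\<not> \<pi> (Suc v) < \<pi> v"
    using assms window_value[OF \<pi> Suc_v] unfolding low_def by auto
  then show ?thesis using Sym_eq_iff[OF \<pi>, of v "Suc v"] by simp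
qed

lemma high_imp_less:
  assumes "high n i \<pi> v"
  shows "\<pi> (Suc v) < \<pi> v"
proof -
  have "Suc v \<in> {1..n}" using window_bounds[OF Suc_v] by simp
  then have "\<not> \<pi> v < \<pi> (Suc v)"
    using assms unfolding high_def by auto
  then show ?thesis using Sym_eq_iff[OF \<pi>, of v "Suc v"] by simp
qed

text \<open>A low value at \<open>v\<close> is below its right neighbour, a high one above it. Hence
  only the last window position, whose successor lies outside, can carry both labels.\<close>

lemma low_not_high: "\<not> (low n i \<pi> v \<and> high n i \<pi> v)"
  using low_imp_less high_imp_less by fastforce

text \<open>The labels travel with the values. All values above the high one lie before
  \<open>Suc v\<close> and not at \<open>v\<close>, hence before \<open>v\<close>; and a low value
  stays low when it moves right, as fewer positions lie behind it.\<close>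

lemma transpose_low_high:
  assumes "low n i \<pi> v" "high n i \<pi> (Suc v)"
  shows "high n i (\<pi> \<circ> transpose v (Suc v)) v" "low n i (\<pi> \<circ> transpose v (Suc v)) (Suc v)"
proof -
  show "high n i (\<pi> \<circ> transpose v (Suc v)) v"
    using assms(2) low_imp_less[OF assms(1)] window_bounds[OF v] unfolding high_def
    by (auto simp: transpose_def less_Suc_eq split: if_splits)
  show "low n i (\<pi> \<circ> transpose v (Suc v)) (Suc v)"
    using assms(1) unfolding low_def transpose_at_base by (auto simp: transpose_def)
qed

lemma transpose_high_low:
  assumes "high n i \<pi> v" "low n i \<pi> (Suc v)"
  shows "low n i (\<pi> \<circ> transpose v (Suc v)) v" "high n i (\<pi> \<circ> transpose v (Suc v)) (Suc v)"
proof -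
  show "low n i (\<pi> \<circ> transpose v (Suc v)) v"
    using assms(2) high_imp_less[OF assms(1)] unfolding low_def transpose_at_base
    by (auto simp: transpose_def split: if_splits)
  show "high n i (\<pi> \<circ> transpose v (Suc v)) (Suc v)"
    using assms(1) high_imp_less[OF assms(1)] unfolding high_def
    by (auto simp: transpose_def less_Suc_eq split: if_splits)
qed

end

section \<open>Label words and the permutations that fit them\<close>

fun has_letter :: "nat \<Rightarrow> nat \<Rightarrow> (nat \<Rightarrow> nat) \<Rightarrow> nat \<Rightarrow> letter \<Rightarrow> bool" where
  "has_letter n i \<pi> v Lo \<longleftrightarrow> low n i \<pi> v"
| "has_letter n i \<pi> v Hi \<longleftrightarrow> high n i \<pi> v"
| "has_letter n i \<pi> v No \<longleftrightarrow> \<not> low n i \<pi> v \<and> \<not> high n i \<pi> v"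

definition letter_pairs ::
    "nat \<Rightarrow> nat \<Rightarrow> (nat \<Rightarrow> nat) \<Rightarrow> letter \<Rightarrow> letter \<Rightarrow> nat set" where
  "letter_pairs n i \<pi> a b = {v \<in> window n i \<pi>. Suc v \<in> window n i \<pi> \<and>
     has_letter n i \<pi> v a \<and> has_letter n i \<pi> (Suc v) b}"

lemma has_letter_unique:
  assumes "has_letter n i \<pi> v c" "has_letter n i \<pi> v d" "\<not> (low n i \<pi> v \<and> high n i \<pi> v)"
  shows "c = d"
  using assms by (cases c; cases d) auto

text \<open>A position that is both low and high admits two letters, so a permutation may fit two words.\<close>

definition fits :: "nat \<Rightarrow> nat \<Rightarrow> (nat \<Rightarrow> nat) \<Rightarrow> letter list \<Rightarrow> bool" where
  "fits n i \<pi> xs \<longleftrightarrow> window n i \<pi> = {i<..i + length xs} \<and>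
     (\<forall>j<length xs. has_letter n i \<pi> (Suc (i + j)) (xs ! j))"

lemma has_letter_transpose_other:
  assumes "\<pi> \<in> Sym n" "v \<in> window n i \<pi>" "Suc v \<in> window n i \<pi>" "u \<noteq> v" "u \<noteq> Suc v"
  shows "has_letter n i (\<pi> \<circ> transpose v (Suc v)) u c \<longleftrightarrow> has_letter n i \<pi> u c"
  using low_transpose_other[OF assms] high_transpose_other[OF assms] by (cases c) simp_all

lemma fits_transpose:
  assumes \<pi>: "\<pi> \<in> Sym n" and "fits n i \<pi> (u @ a # b # w)" and ab: "{a, b} = {Lo, Hi}"
  defines "v \<equiv> Suc (i + length u)"
  shows "\<pi> \<circ> transpose v (Suc v) \<in> Sym n"
    and "fits n i (\<pi> \<circ> transpose v (Suc v)) (u @ b # a # w)"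
proof -
  let ?xs = "u @ a # b # w" and ?ys = "u @ b # a # w" and ?\<rho> = "\<pi> \<circ> transpose v (Suc v)"
  have win: "window n i \<pi> = {i<..i + length ?xs}"
    and letters: "\<And>j. j < length ?xs \<Longrightarrow> has_letter n i \<pi> (Suc (i + j)) (?xs ! j)"
    using assms(2) by (auto simp: fits_def)
  have v: "v \<in> window n i \<pi>" "Suc v \<in> window n i \<pi>"
    using win by (auto simp: v_def)
  show "?\<rho> \<in> Sym n"
    using Sym_transpose[OF \<pi>] window_bounds[OF v(1)] window_bounds[OF v(2)] by simp
  have "has_letter n i \<pi> v a" "has_letter n i \<pi> (Suc v) b"
    using letters[of "length u"] letters[of "Suc (length u)"] by (auto simp: v_def nth_append)
  then have new: "has_letter n i ?\<rho> v b" "has_letter n i ?\<rho> (Suc v) a"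
    using ab transpose_low_high[OF \<pi> v] transpose_high_low[OF \<pi> v]
    by (auto simp: doubleton_eq_iff)
  have "has_letter n i ?\<rho> (Suc (i + j)) (?ys ! j)" if "j < length ?ys" for j
  proof (cases "j = length u \<or> j = Suc (length u)")
    case True
    then show ?thesis using new by (auto simp: v_def nth_append)
  next
    case False
    then have "?ys ! j = ?xs ! j" by (auto simp: nth_append nth_Cons')
    moreover have "Suc (i + j) \<noteq> v" "Suc (i + j) \<noteq> Suc v" using False by (auto simp: v_def)
    ultimately show ?thesis
      using has_letter_transpose_other[OF \<pi> v, of "Suc (i + j)"] letters[of j] that by simp
  qed
  then show "fits n i ?\<rho> ?ys"
    using win window_transpose[OF \<pi> v] by (simp add: fits_def)
qed

lemma card_transpose_cong:
  assumes "\<And>\<pi>. P \<pi> \<Longrightarrow> Q (\<pi> \<circ> transpose x y)" "\<And>\<pi>. Q \<pi> \<Longrightarrow> P (\<pi> \<circ> transpose x y)"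
  shows "card {\<pi>. P \<pi>} = card {\<pi>. Q \<pi>}"
proof -
  let ?f = "\<lambda>\<pi>. \<pi> \<circ> transpose x y"
  have "bij_betw ?f {\<pi>. P \<pi>} {\<pi>. Q \<pi>}"
    using assms by (intro bij_betw_byWitness[where f' = ?f]) (auto simp: comp_assoc)
  then show ?thesis by (rule bij_betw_same_card)
qed

lemma card_fits_swap:
  "card {\<pi> \<in> Sym n. fits n i \<pi> (u @ Lo # Hi # w)} = card {\<pi> \<in> Sym n. fits n i \<pi> (u @ Hi # Lo # w)}"
proof (rule card_transpose_cong[of _ _ "Suc (i + length u)" "Suc (Suc (i + length u))"])
  show "\<pi> \<circ> transpose (Suc (i + length u)) (Suc (Suc (i + length u))) \<in> Sym n \<and>
      fits n i (\<pi> \<circ> transpose (Suc (i + length u)) (Suc (Suc (i + length u)))) (u @ Hi # Lo # w)"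
    if "\<pi> \<in> Sym n \<and> fits n i \<pi> (u @ Lo # Hi # w)" for \<pi>
    using fits_transpose[OF conjunct1 conjunct2, OF that that refl] by blast
  show "\<pi> \<circ> transpose (Suc (i + length u)) (Suc (Suc (i + length u))) \<in> Sym n \<and>
      fits n i (\<pi> \<circ> transpose (Suc (i + length u)) (Suc (Suc (i + length u)))) (u @ Lo # Hi # w)"
    if "\<pi> \<in> Sym n \<and> fits n i \<pi> (u @ Hi # Lo # w)" for \<pi>
    using fits_transpose[OF conjunct1 conjunct2, OF that that insert_commute] by blast
qed

text \<open>The exchanged letters lie before the appended one, so one transposition serves both
  words at once.\<close>

lemma card_fits_both_swap:
  "card {\<pi> \<in> Sym n. fits n i \<pi> ((u @ Lo # Hi # w) @ [Lo]) \<and> fits n i \<pi> ((u @ Lo # Hi # w) @ [Hi])} =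
   card {\<pi> \<in> Sym n. fits n i \<pi> ((u @ Hi # Lo # w) @ [Lo]) \<and> fits n i \<pi> ((u @ Hi # Lo # w) @ [Hi])}"
proof (rule card_transpose_cong[of _ _ "Suc (i + length u)" "Suc (Suc (i + length u))"])
  let ?\<tau> = "transpose (Suc (i + length u)) (Suc (Suc (i + length u)))"
  have step: "\<pi> \<circ> ?\<tau> \<in> Sym n \<and> fits n i (\<pi> \<circ> ?\<tau>) ((u @ b # a # w) @ [c])"
    if "\<pi> \<in> Sym n" "fits n i \<pi> ((u @ a # b # w) @ [c])" "{a, b} = {Lo, Hi}" for \<pi> a b c
  proof -
    have eq: "(u @ x # y # w) @ [c] = u @ x # y # (w @ [c])" for x y by simp
    show ?thesis
      using fits_transpose[OF that(1) that(2)[unfolded eq] that(3)] unfolding eq by blast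
  qed
  show "\<pi> \<circ> ?\<tau> \<in> Sym n \<and> fits n i (\<pi> \<circ> ?\<tau>) ((u @ Hi # Lo # w) @ [Lo]) \<and>
      fits n i (\<pi> \<circ> ?\<tau>) ((u @ Hi # Lo # w) @ [Hi])"
    if "\<pi> \<in> Sym n \<and> fits n i \<pi> ((u @ Lo # Hi # w) @ [Lo]) \<and> fits n i \<pi> ((u @ Lo # Hi # w) @ [Hi])"
    for \<pi>
    using step[of \<pi> Lo Hi Lo] step[of \<pi> Lo Hi Hi] that by blast
  show "\<pi> \<circ> ?\<tau> \<in> Sym n \<and> fits n i (\<pi> \<circ> ?\<tau>) ((u @ Lo # Hi # w) @ [Lo]) \<and>
      fits n i (\<pi> \<circ> ?\<tau>) ((u @ Lo # Hi # w) @ [Hi])"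
    if "\<pi> \<in> Sym n \<and> fits n i \<pi> ((u @ Hi # Lo # w) @ [Lo]) \<and> fits n i \<pi> ((u @ Hi # Lo # w) @ [Hi])"
    for \<pi>
    using step[of \<pi> Hi Lo Lo, OF _ _ insert_commute] step[of \<pi> Hi Lo Hi, OF _ _ insert_commute] that
    by blast
qed

interpretation fits: swap_invariant "\<lambda>xs. card {\<pi> \<in> Sym n. fits n i \<pi> xs}" for n i
  by unfold_locales (rule card_fits_swap)

interpretation fits_both:
  swap_invariant "\<lambda>xs. card {\<pi> \<in> Sym n. fits n i \<pi> (xs @ [Lo]) \<and> fits n i \<pi> (xs @ [Hi])}" for n i
  by unfold_locales (rule card_fits_both_swap)

section \<open>Letter pairs of a permutation as adjacencies in its words\<close>

lemma fits_length_le: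
  assumes "fits n i \<pi> xs"
  shows "length xs \<le> n"
proof (cases "xs = []")
  case False
  then have "i + length xs \<in> window n i \<pi>" using assms by (simp add: fits_def)
  then show ?thesis using window_bounds by fastforce
qed simp

lemma window_interval: "\<exists>r. window n i \<pi> = {i<..i + r}"
proof (cases "window n i \<pi> = {}")
  case True
  then show ?thesis by (intro exI[of _ 0]) simp
next
  case False
  let ?M = "Max (window n i \<pi>)"
  have fin: "finite (window n i \<pi>)"
    by (rule finite_subset[of _ "{..n}"]) (auto simp: window_def)
  \<comment> \<open>The window condition passes from the maximum down to every smaller position
    above \<open>i\<close>.\<close>
  have "u \<in> window n i \<pi>" if "i < u" "u \<le> ?M" for u
    using that Max_in[OF fin False] by (fastforce simp: window_def)
  then have "window n i \<pi> = {i<..?M}"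
    using Max_ge[OF fin] window_bounds by auto
  moreover have "i \<le> ?M" using window_bounds[OF Max_in[OF fin False]] by simp
  ultimately show ?thesis by (intro exI[of _ "?M - i"]) simp
qed

text \<open>Only the last position may admit two letters, and it can be the second member of a pair
  but never the first. So it suffices that the word ends in \<open>b\<close> whenever that position
  admits \<open>b\<close>.\<close>

lemma card_letter_pairs:
  assumes \<pi>: "\<pi> \<in> Sym n" and fits: "fits n i \<pi> xs"
    and last: "xs \<noteq> [] \<Longrightarrow> has_letter n i \<pi> (i + length xs) b \<Longrightarrow> last xs = b"
  shows "card (letter_pairs n i \<pi> a b) = adj a b xs"
proof -
  let ?J = "{j. Suc j < length xs \<and> xs ! j = a \<and> xs ! Suc j = b}"
  have win: "window n i \<pi> = {i<..i + length xs}"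
    and letters: "\<And>j. j < length xs \<Longrightarrow> has_letter n i \<pi> (Suc (i + j)) (xs ! j)"
    using fits by (auto simp: fits_def)
  have first: "xs ! j = c" if "Suc j < length xs" "has_letter n i \<pi> (Suc (i + j)) c" for j c
    using low_not_high[OF \<pi>, of "Suc (i + j)" i] has_letter_unique[OF letters[of j] that(2)] that win
    by simp
  have second: "xs ! j = b" if "j < length xs" "has_letter n i \<pi> (Suc (i + j)) b" for j
  proof (cases "Suc j < length xs")
    case True
    then show ?thesis using first that by simp
  next
    case False
    then have j: "length xs = Suc j" using that by simp
    moreover from j have "xs \<noteq> []" by auto
    ultimately show ?thesis using last that(2) by (simp add: last_conv_nth)
  qed
  have "letter_pairs n i \<pi> a b = (\<lambda>j. Suc (i + j)) ` ?J"
  proof (intro set_eqI iffI)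
    fix v
    assume v: "v \<in> letter_pairs n i \<pi> a b"
    then obtain j where "v = Suc (i + j)"
      by (auto simp: letter_pairs_def win dest: less_imp_Suc_add)
    then show "v \<in> (\<lambda>j. Suc (i + j)) ` ?J"
      using v first[of j] second[of "Suc j"] by (auto simp: letter_pairs_def win)
  next
    fix v
    assume "v \<in> (\<lambda>j. Suc (i + j)) ` ?J"
    then obtain j where "v = Suc (i + j)" "Suc j < length xs" "xs ! j = a" "xs ! Suc j = b"
      by auto
    then show "v \<in> letter_pairs n i \<pi> a b"
      using letters[of j] letters[of "Suc j"] by (simp add: letter_pairs_def win)
  qed
  then show ?thesis
    by (simp add: adj_conv_card card_image inj_on_def)
qed

lemma fits_length_eq:
  assumes "fits n i \<pi> xs" "fits n i \<pi> ys"
  shows "length xs = length ys"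
  using assms unfolding fits_def by (metis card_greaterThanAtMost add_diff_cancel_left')

lemma fits_nth_eq:
  assumes "fits n i \<pi> xs" "fits n i \<pi> ys" "j < length xs"
    and "\<not> (low n i \<pi> (Suc (i + j)) \<and> high n i \<pi> (Suc (i + j)))"
  shows "xs ! j = ys ! j"
  using has_letter_unique[OF _ _ assms(4)] assms fits_length_eq[OF assms(1,2)]
  unfolding fits_def by metis

lemma fits_last:
  assumes "fits n i \<pi> xs" "xs \<noteq> []"
  shows "has_letter n i \<pi> (i + length xs) (last xs)"
proof -
  obtain r where "length xs = Suc r" using assms(2) by (cases xs) auto
  then show ?thesis
    using assms by (auto simp: fits_def last_conv_nth dest: spec[of _ r])
qed

text \<open>Earlier positions have a unique letter by \<open>low_not_high\<close>, so the last
  position decides between the cases. If it admits both labels, each count is read off the word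
  whose last letter can end the counted pairs.\<close>

lemma fits_cases:
  assumes \<pi>: "\<pi> \<in> Sym n"
  obtains (unique) xs where "{xs. fits n i \<pi> xs} = {xs}"
      "{ys. fits n i \<pi> (ys @ [Lo]) \<and> fits n i \<pi> (ys @ [Hi])} = {}"
      "card (letter_pairs n i \<pi> Lo Hi) = adj Lo Hi xs" "card (letter_pairs n i \<pi> Hi Lo) = adj Hi Lo xs"
    | (both) ys where "{xs. fits n i \<pi> xs} = {ys @ [Lo], ys @ [Hi]}"
      "{ys. fits n i \<pi> (ys @ [Lo]) \<and> fits n i \<pi> (ys @ [Hi])} = {ys}"
      "card (letter_pairs n i \<pi> Lo Hi) = adj Lo Hi (ys @ [Hi])"
      "card (letter_pairs n i \<pi> Hi Lo) = adj Hi Lo (ys @ [Lo])"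
proof -
  obtain r where win: "window n i \<pi> = {i<..i + r}"
    using window_interval by blast
  \<comment> \<open>A canonical admissible letter. Where both labels hold it is \<open>Lo\<close>,
    but the words built below apply it to unambiguous positions only.\<close>
  define lab where
    "lab j = (if low n i \<pi> (Suc (i + j)) then Lo else if high n i \<pi> (Suc (i + j)) then Hi else No)" for j
  have lab: "has_letter n i \<pi> (Suc (i + j)) (lab j)" for j
    by (simp add: lab_def)
  have excl: "\<not> (low n i \<pi> (Suc (i + j)) \<and> high n i \<pi> (Suc (i + j)))" if "Suc j < r" for j
    using low_not_high[OF \<pi>, of "Suc (i + j)" i] that win by simp
  have len: "length xs = r" if "fits n i \<pi> xs" for xs
  proof -
    have "card {i<..i + r} = card {i<..i + length xs}" using that win by (simp add: fits_def)
    then show ?thesis by simp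
  qed
  show thesis
  proof (cases "0 < r \<and> low n i \<pi> (i + r) \<and> high n i \<pi> (i + r)")
    case False
    define xs where "xs = map lab [0..<r]"
    have excl': "\<not> (low n i \<pi> (Suc (i + j)) \<and> high n i \<pi> (Suc (i + j)))" if "j < r" for j
      using excl[of j] False that by (cases "Suc j = r") auto
    have fits: "fits n i \<pi> xs"
      using win lab by (simp add: fits_def xs_def)
    have uniq: "zs = xs" if "fits n i \<pi> zs" for zs
      using len[OF that] len[OF fits] fits_nth_eq[OF that fits] excl' by (simp add: nth_equalityI)
    have last: "last xs = c" if "xs \<noteq> []" "has_letter n i \<pi> (i + length xs) c" for c
      using has_letter_unique[OF fits_last[OF fits that(1)] that(2)] False that(1) len[OF fits] by auto
    show thesis
    proof (rule unique)
      show "{xs. fits n i \<pi> xs} = {xs}"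
        using uniq fits by blast
      show "{ys. fits n i \<pi> (ys @ [Lo]) \<and> fits n i \<pi> (ys @ [Hi])} = {}"
        using uniq by (metis (mono_tags, lifting) Collect_empty_eq last_snoc letter.distinct(1))
      show "card (letter_pairs n i \<pi> Lo Hi) = adj Lo Hi xs"
        by (rule card_letter_pairs[OF \<pi> fits last])
      show "card (letter_pairs n i \<pi> Hi Lo) = adj Hi Lo xs"
        by (rule card_letter_pairs[OF \<pi> fits last])
    qed
  next
    case True
    then obtain s where r: "r = Suc s" by (cases r) auto
    define ys where "ys = map lab [0..<s]"
    have fits: "fits n i \<pi> (ys @ [c])" if "c \<noteq> No" for c
      using win lab True r that by (cases c) (auto simp: fits_def ys_def nth_append less_Suc_eq)
    have cases: "zs = ys @ [Lo] \<or> zs = ys @ [Hi]" if "fits n i \<pi> zs" for zs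
    proof -
      have zs: "length zs = Suc s" using len[OF that] r by simp
      then have "zs \<noteq> []" by auto
      then obtain us c where us: "zs = us @ [c]" by (cases zs rule: rev_cases) auto
      have "us ! j = ys ! j" if "j < s" for j
        using fits_nth_eq[OF \<open>fits n i \<pi> zs\<close> fits[of Lo], of j] excl[of j] that r us zs
        by (simp add: nth_append ys_def)
      then have "us = ys" using zs us by (simp add: nth_equalityI ys_def)
      moreover have "c \<noteq> No" using fits_last[OF that \<open>zs \<noteq> []\<close>] zs us True r by auto
      ultimately show ?thesis using us by (cases c) auto
    qed
    show thesis
    proof (rule both)
      show "card (letter_pairs n i \<pi> Lo Hi) = adj Lo Hi (ys @ [Hi])"
        by (rule card_letter_pairs[OF \<pi> fits]) auto
      show "card (letter_pairs n i \<pi> Hi Lo) = adj Hi Lo (ys @ [Lo])"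
        by (rule card_letter_pairs[OF \<pi> fits]) auto
      show "{xs. fits n i \<pi> xs} = {ys @ [Lo], ys @ [Hi]}"
        using cases fits by auto
      show "{ys. fits n i \<pi> (ys @ [Lo]) \<and> fits n i \<pi> (ys @ [Hi])} = {ys}"
        using cases fits by fastforce
    qed
  qed
qed

lemma finite_words [simp]: "finite (words n k l)"
proof -
  have "finite (UNIV :: letter set)"
    by (rule finite_subset[of _ "{Lo, Hi, No}"]) (auto intro: letter.exhaust)
  from finite_lists_length_le[OF this, of n] show ?thesis
    by (rule rev_finite_subset) (auto simp: words_def)
qed

lemma card_fits_words:
  assumes \<pi>: "\<pi> \<in> Sym n"
  shows "of_bool (card (letter_pairs n i \<pi> Lo Hi) = k \<and> card (letter_pairs n i \<pi> Hi Lo) = l) +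
     card {ys \<in> words n k l. fits n i \<pi> (ys @ [Lo]) \<and> fits n i \<pi> (ys @ [Hi])} =
     card {xs \<in> words n k l. fits n i \<pi> xs}"
  using \<pi>
proof (cases rule: fits_cases[where i = i])
  case (unique xs)
  have fits: "fits n i \<pi> zs \<longleftrightarrow> zs = xs" for zs
    using unique(1) by blast
  have "{zs \<in> words n k l. fits n i \<pi> zs} = {zs. zs = xs \<and> adj Lo Hi xs = k \<and> adj Hi Lo xs = l}"
    using fits fits_length_le[of n i \<pi> xs] by (auto simp: words_def)
  moreover have "{ys \<in> words n k l. fits n i \<pi> (ys @ [Lo]) \<and> fits n i \<pi> (ys @ [Hi])} = {}"
    using unique(2) by auto
  ultimately show ?thesis using unique(3,4) by auto
next
  case (both ys)
  have fits: "fits n i \<pi> zs \<longleftrightarrow> zs = ys @ [Lo] \<or> zs = ys @ [Hi]" for zs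
    using both(1) by blast
  then have len: "Suc (length ys) \<le> n"
    using fits_length_le[of n i \<pi> "ys @ [Lo]"] by simp
  have "{zs \<in> words n k l. fits n i \<pi> zs} = words n k l \<inter> {ys @ [Lo], ys @ [Hi]}"
    unfolding fits by blast
  then have 1: "card {zs \<in> words n k l. fits n i \<pi> zs} =
      of_bool (adj Lo Hi (ys @ [Lo]) = k \<and> adj Hi Lo (ys @ [Lo]) = l) +
      of_bool (adj Lo Hi (ys @ [Hi]) = k \<and> adj Hi Lo (ys @ [Hi]) = l)"
    using len by (simp add: words_def)
  have "{ys \<in> words n k l. fits n i \<pi> (ys @ [Lo]) \<and> fits n i \<pi> (ys @ [Hi])} = words n k l \<inter> {ys}"
    unfolding fits by auto
  then have 2: "card {ys \<in> words n k l. fits n i \<pi> (ys @ [Lo]) \<and> fits n i \<pi> (ys @ [Hi])} =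
      of_bool (adj Lo Hi ys = k \<and> adj Hi Lo ys = l)"
    using len by (simp add: words_def)
  show ?thesis
  proof (cases ys rule: rev_cases)
    case Nil
    then show ?thesis using 1 2 both(3,4) by simp
  next
    \<comment> \<open>If \<open>ys\<close> ends in \<open>Lo\<close>, then \<open>ys @ [Hi]\<close>
      has the actual counts and \<open>ys @ [Lo]\<close> those of \<open>ys\<close>; if it ends in
      \<open>Hi\<close>, the roles are exchanged; if it ends in \<open>No\<close>, all these counts
      coincide.\<close>
    case (snoc zs c)
    then show ?thesis using 1 2 both(3,4) by (cases c) (simp_all add: adj_snoc2 adj_snoc_other)
  qed
qed

lemma sum_card_swap:
  assumes "finite A" "finite B"
  shows "(\<Sum>x\<in>A. card {y \<in> B. P x y}) = (\<Sum>y\<in>B. card {x \<in> A. P x y})"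
proof -
  have "card {y \<in> B. P x y} = (\<Sum>y\<in>B. of_bool (P x y))" for x
    using assms(2) by (simp add: of_bool_def sum.If_cases Int_def)
  moreover have "card {x \<in> A. P x y} = (\<Sum>x\<in>A. of_bool (P x y))" for y
    using assms(1) by (simp add: of_bool_def sum.If_cases Int_def)
  ultimately show ?thesis by (simp add: sum.swap[of _ B A])
qed

lemma card_pairs_count:
  "card {\<pi> \<in> Sym n. card (letter_pairs n i \<pi> Lo Hi) = k \<and> card (letter_pairs n i \<pi> Hi Lo) = l} +
     (\<Sum>ys\<in>words n k l. card {\<pi> \<in> Sym n. fits n i \<pi> (ys @ [Lo]) \<and> fits n i \<pi> (ys @ [Hi])}) =
   (\<Sum>xs\<in>words n k l. card {\<pi> \<in> Sym n. fits n i \<pi> xs})"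
proof -
  let ?P = "\<lambda>\<pi>. card (letter_pairs n i \<pi> Lo Hi) = k \<and> card (letter_pairs n i \<pi> Hi Lo) = l"
  have "card {\<pi> \<in> Sym n. ?P \<pi>} = (\<Sum>\<pi>\<in>Sym n. of_bool (?P \<pi>))"
    by (simp add: of_bool_def sum.If_cases Int_def)
  moreover have "(\<Sum>ys\<in>words n k l. card {\<pi> \<in> Sym n. fits n i \<pi> (ys @ [Lo]) \<and> fits n i \<pi> (ys @ [Hi])}) =
      (\<Sum>\<pi>\<in>Sym n. card {ys \<in> words n k l. fits n i \<pi> (ys @ [Lo]) \<and> fits n i \<pi> (ys @ [Hi])})"
    by (rule sum_card_swap) simp_all
  moreover have "(\<Sum>xs\<in>words n k l. card {\<pi> \<in> Sym n. fits n i \<pi> xs}) =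
      (\<Sum>\<pi>\<in>Sym n. card {xs \<in> words n k l. fits n i \<pi> xs})"
    by (rule sum_card_swap) simp_all
  moreover have "(\<Sum>\<pi>\<in>Sym n. of_bool (?P \<pi>)) +
      (\<Sum>\<pi>\<in>Sym n. card {ys \<in> words n k l. fits n i \<pi> (ys @ [Lo]) \<and> fits n i \<pi> (ys @ [Hi])}) =
      (\<Sum>\<pi>\<in>Sym n. card {xs \<in> words n k l. fits n i \<pi> xs})"
    unfolding sum.distrib[symmetric] by (intro sum.cong refl card_fits_words)
  ultimately show ?thesis by (simp only:)
qed

text \<open>Both word sums in \<open>card_pairs_count\<close> are symmetric in \<open>k\<close> and
  \<open>l\<close>, hence so is their difference.\<close>

proposition card_pairs_swap:
  "card {\<pi> \<in> Sym n. card (letter_pairs n i \<pi> Lo Hi) = k \<and> card (letter_pairs n i \<pi> Hi Lo) = l} =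
   card {\<pi> \<in> Sym n. card (letter_pairs n i \<pi> Lo Hi) = l \<and> card (letter_pairs n i \<pi> Hi Lo) = k}"
  using card_pairs_count[of n i k l] card_pairs_count[of n i l k]
    fits.sum_words_swap[of n i n k l] fits_both.sum_words_swap[of n i n k l]
  by simp

section \<open>Occurrences\<close>

text \<open>Let \<open>v \<le> w\<close> and suppose the bases differ. The windows force
  \<open>i'\<close> to have the smaller value and to lie behind \<open>Suc v\<close>. Then the high
  position of the first pair is before \<open>i'\<close> and that of the second behind it, so
  neither high value can exceed the other, although they are distinct.\<close>

lemma letter_pairs_base_unique:
  assumes \<pi>: "\<pi> \<in> Sym n" and i: "i \<in> {1..n}" "i' \<in> {1..n}"
    and v: "v \<in> letter_pairs n i \<pi> a b" "{a, b} = {Lo, Hi}"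
    and w: "w \<in> letter_pairs n i' \<pi> c d" "{c, d} = {Lo, Hi}"
  shows "i = i'"
proof -
  have main: "i = i'"
    if v: "v \<in> letter_pairs n i \<pi> a b" "{a, b} = {Lo, Hi}" and i: "i \<in> {1..n}"
      and w: "w \<in> letter_pairs n i' \<pi> c d" "{c, d} = {Lo, Hi}" and i': "i' \<in> {1..n}"
      and "v \<le> w"
    for v a b i w c d i'
  proof (rule ccontr)
    assume "i \<noteq> i'"
    then have neq: "\<pi> i \<noteq> \<pi> i'" using Sym_eq_iff[OF \<pi>] by simp
    have v_win: "v \<in> window n i \<pi>" "Suc v \<in> window n i \<pi>"
      and w_win: "w \<in> window n i' \<pi>" "Suc w \<in> window n i' \<pi>"
      using v(1) w(1) by (auto simp: letter_pairs_def)
    \<comment> \<open>Otherwise the window of \<open>i'\<close> would put \<open>i\<close> behind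
      \<open>Suc w\<close>, although \<open>i < v \<le> w\<close>.\<close>
    have "\<not> \<pi> i < \<pi> i'"
      using w_win(2) window_bounds[OF v_win(1)] i \<open>v \<le> w\<close> by (auto simp: window_def)
    with neq have "Suc v < i'"
      using v_win(2) i' by (auto simp: window_def)
    have "\<exists>h\<in>{v, Suc v}. high n i \<pi> h" "\<exists>h\<in>{w, Suc w}. high n i' \<pi> h"
      using v w by (auto simp: letter_pairs_def doubleton_eq_iff)
    then obtain h h' where h: "h \<in> {v, Suc v}" "high n i \<pi> h"
      and h': "h' \<in> {w, Suc w}" "high n i' \<pi> h'"
      by blast
    have less: "h < i'" "i' < h'"
      using h(1) h'(1) \<open>Suc v < i'\<close> window_bounds[OF w_win(1)] by auto
    have "h \<in> {1..n}" "h' \<in> {1..n}"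
      using h(1) h'(1) v_win w_win by (auto simp: window_def)
    then have "\<not> \<pi> h < \<pi> h'" "\<not> \<pi> h' < \<pi> h"
      using h(2) h'(2) less unfolding high_def by fastforce+
    then show False using Sym_eq_iff[OF \<pi>, of h h'] less by simp
  qed
  show ?thesis
    using main[OF v i(1) w i(2)] main[OF w i(2) v i(1)] by linarith
qed

text \<open>Taking the borders as arbitrary functions lets explicit lists replace
  \<open>bordered\<close>, and lets inversion act by exchanging the last two arguments.\<close>

definition avoids ::
    "nat \<Rightarrow> (nat \<Rightarrow> nat) \<Rightarrow> (nat \<times> nat) set \<Rightarrow> (nat \<Rightarrow> nat) \<Rightarrow> (nat \<Rightarrow> nat) \<Rightarrow> bool" where
  "avoids n \<pi> S ps vs \<longleftrightarrow> (\<forall>(a, b)\<in>S. \<forall>m\<in>{1..n}.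
     \<not> (ps a < m \<and> m < ps (a + 1) \<and> vs b < \<pi> m \<and> \<pi> m < vs (b + 1)))"

lemma is_occurrence_three_iff:
  "is_occurrence n \<pi> (3, \<tau>, S) I \<longleftrightarrow> I \<subseteq> {1..n} \<and> card I = 3 \<and>
     (\<forall>a\<in>{1, 2, 3}. \<forall>b\<in>{1, 2, 3}. \<pi> (bordered n I a) < \<pi> (bordered n I b) \<longleftrightarrow> \<tau> a < \<tau> b) \<and>
     avoids n \<pi> S (bordered n I) (bordered n (\<pi> ` I))"
proof -
  have "{1..3::nat} = {1, 2, 3}" by auto
  then show ?thesis unfolding is_occurrence_def avoids_def Let_def by auto
qed

lemma bordered_three:
  assumes "x < y" "y < z"
  shows "bordered n {x, y, z} = (!) [0, x, y, z, n + 1]"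
  using assms by (simp add: bordered_def fun_eq_iff)

lemma card_three_iff:
  fixes I :: "nat set"
  shows "card I = 3 \<longleftrightarrow> (\<exists>x y z. I = {x, y, z} \<and> x < y \<and> y < z)"
proof
  assume I: "card I = 3"
  define xs where "xs = sorted_list_of_set I"
  have "length xs = Suc (Suc (Suc 0))" using I by (simp add: xs_def)
  then obtain x y z where xs: "xs = [x, y, z]"
    by (auto simp: length_Suc_conv)
  have "finite I" using I by (simp add: card_ge_0_finite)
  then have "I = set xs" by (simp add: xs_def)
  then have "I = {x, y, z}" using xs by simp
  moreover have "sorted_wrt (<) xs" by (simp add: xs_def)
  then have "x < y" "y < z" using xs by simp_all
  ultimately show "\<exists>x y z. I = {x, y, z} \<and> x < y \<and> y < z" by blast
qed auto

lemma is_occurrence_123: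
  "is_occurrence n \<pi> (3, one_line [1,2,3], S) I \<longleftrightarrow>
     (\<exists>x y z. I = {x, y, z} \<and> 1 \<le> x \<and> x < y \<and> y < z \<and> z \<le> n \<and> \<pi> x < \<pi> y \<and> \<pi> y < \<pi> z \<and>
        avoids n \<pi> S ((!) [0, x, y, z, n + 1]) ((!) [0, \<pi> x, \<pi> y, \<pi> z, n + 1]))"
proof -
  have *: "is_occurrence n \<pi> (3, one_line [1,2,3], S) {x, y, z} \<longleftrightarrow>
      1 \<le> x \<and> z \<le> n \<and> \<pi> x < \<pi> y \<and> \<pi> y < \<pi> z \<and>
      avoids n \<pi> S ((!) [0, x, y, z, n + 1]) ((!) [0, \<pi> x, \<pi> y, \<pi> z, n + 1])"
    if "x < y" "y < z" for x y z
  proof -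
    have "bordered n (\<pi> ` {x, y, z}) = (!) [0, \<pi> x, \<pi> y, \<pi> z, n + 1]" if "\<pi> x < \<pi> y" "\<pi> y < \<pi> z"
      using bordered_three[OF that] by (simp add: insert_commute)
    moreover have "(\<forall>a\<in>{1, 2, 3}. \<forall>b\<in>{1, 2, 3}.
        \<pi> (bordered n {x, y, z} a) < \<pi> (bordered n {x, y, z} b) \<longleftrightarrow> one_line [1,2,3] a < one_line [1,2,3] b) \<longleftrightarrow>
        \<pi> x < \<pi> y \<and> \<pi> y < \<pi> z"
      unfolding bordered_three[OF that] one_line_123 by auto
    moreover have "{x, y, z} \<subseteq> {1..n} \<and> card {x, y, z} = 3 \<longleftrightarrow> 1 \<le> x \<and> z \<le> n"
      using that by auto
    ultimately show ?thesis
      unfolding is_occurrence_three_iff bordered_three[OF that] by metis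
  qed
  have "card I = 3" if "is_occurrence n \<pi> (3, one_line [1,2,3], S) I"
    using that by (simp add: is_occurrence_three_iff)
  then show ?thesis using * card_three_iff[of I] by blast
qed

lemma is_occurrence_132:
  "is_occurrence n \<pi> (3, one_line [1,3,2], S) I \<longleftrightarrow>
     (\<exists>x y z. I = {x, y, z} \<and> 1 \<le> x \<and> x < y \<and> y < z \<and> z \<le> n \<and> \<pi> x < \<pi> z \<and> \<pi> z < \<pi> y \<and>
        avoids n \<pi> S ((!) [0, x, y, z, n + 1]) ((!) [0, \<pi> x, \<pi> z, \<pi> y, n + 1]))"
proof -
  have *: "is_occurrence n \<pi> (3, one_line [1,3,2], S) {x, y, z} \<longleftrightarrow>
      1 \<le> x \<and> z \<le> n \<and> \<pi> x < \<pi> z \<and> \<pi> z < \<pi> y \<and>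
      avoids n \<pi> S ((!) [0, x, y, z, n + 1]) ((!) [0, \<pi> x, \<pi> z, \<pi> y, n + 1])"
    if "x < y" "y < z" for x y z
  proof -
    have "bordered n (\<pi> ` {x, y, z}) = (!) [0, \<pi> x, \<pi> z, \<pi> y, n + 1]" if "\<pi> x < \<pi> z" "\<pi> z < \<pi> y"
      using bordered_three[OF that] by (simp add: insert_commute)
    moreover have "(\<forall>a\<in>{1, 2, 3}. \<forall>b\<in>{1, 2, 3}.
        \<pi> (bordered n {x, y, z} a) < \<pi> (bordered n {x, y, z} b) \<longleftrightarrow> one_line [1,3,2] a < one_line [1,3,2] b) \<longleftrightarrow>
        \<pi> x < \<pi> z \<and> \<pi> z < \<pi> y"
      unfolding bordered_three[OF that] one_line_132 by (auto simp: transpose_def)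
    moreover have "{x, y, z} \<subseteq> {1..n} \<and> card {x, y, z} = 3 \<longleftrightarrow> 1 \<le> x \<and> z \<le> n"
      using that by auto
    ultimately show ?thesis
      unfolding is_occurrence_three_iff bordered_three[OF that] by metis
  qed
  have "card I = 3" if "is_occurrence n \<pi> (3, one_line [1,3,2], S) I"
    using that by (simp add: is_occurrence_three_iff)
  then show ?thesis using * card_three_iff[of I] by blast
qed

section \<open>Inversion of permutations and transposed shadings\<close>

lemma avoids_inv:
  assumes "\<pi> \<in> Sym n"
  shows "avoids n (inv \<pi>) (S\<inverse>) vs ps \<longleftrightarrow> avoids n \<pi> S ps vs"
proof -
  have \<pi>: "\<pi> permutes {1..n}" using assms by (simp add: Sym_def)
  \<comment> \<open>Reindexing along \<pi> turns a condition on the entries of the inverse into one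
    on the entries of \<pi>.\<close>
  have swap: "(\<forall>m\<in>{1..n}. P m (inv \<pi> m)) \<longleftrightarrow> (\<forall>m\<in>{1..n}. P (\<pi> m) m)"
    for P :: "nat \<Rightarrow> nat \<Rightarrow> bool"
  proof -
    have "(\<forall>m\<in>\<pi> ` {1..n}. P m (inv \<pi> m)) \<longleftrightarrow> (\<forall>m\<in>{1..n}. P (\<pi> m) m)"
      by (simp add: permutes_inverses[OF \<pi>])
    then show ?thesis by (simp only: permutes_image[OF \<pi>])
  qed
  have "(\<forall>m\<in>{1..n}. \<not> (vs b < m \<and> m < vs (b + 1) \<and> ps a < inv \<pi> m \<and> inv \<pi> m < ps (a + 1))) \<longleftrightarrow>
      (\<forall>m\<in>{1..n}. \<not> (ps a < m \<and> m < ps (a + 1) \<and> vs b < \<pi> m \<and> \<pi> m < vs (b + 1)))" for a b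
    using swap[of "\<lambda>m m'. \<not> (vs b < m \<and> m < vs (b + 1) \<and> ps a < m' \<and> m' < ps (a + 1))"] by blast
  moreover have "(\<forall>(b, a)\<in>S\<inverse>. A b a) \<longleftrightarrow> (\<forall>(a, b)\<in>S. A b a)" for A :: "nat \<Rightarrow> nat \<Rightarrow> bool"
    by auto
  ultimately show ?thesis
    unfolding avoids_def by (simp only:)
qed

text \<open>The values of an occurrence become its positions; the pattern is preserved because 123
  and 132 are involutions.\<close>

lemma is_occurrence_inv:
  assumes \<pi>: "\<pi> \<in> Sym n" and \<tau>: "\<tau> \<in> {one_line [1,2,3], one_line [1,3,2]}"
    and occ: "is_occurrence n \<pi> (3, \<tau>, S) I"
  shows "is_occurrence n (inv \<pi>) (3, \<tau>, S\<inverse>) (\<pi> ` I)"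
proof -
  have perm: "\<pi> permutes {1..n}" using \<pi> by (simp add: Sym_def)
  have range: "1 \<le> \<pi> m \<and> \<pi> m \<le> n" if "1 \<le> m" "m \<le> n" for m
    using permutes_in_image[OF perm, of m] that by simp
  note [simp] = permutes_inverses[OF perm]
  consider "\<tau> = one_line [1,2,3]" | "\<tau> = one_line [1,3,2]" using \<tau> by blast
  then show ?thesis
  proof cases
    case 1
    obtain x y z where I: "I = {x, y, z}" "1 \<le> x" "x < y" "y < z" "z \<le> n"
      "\<pi> x < \<pi> y" "\<pi> y < \<pi> z" "avoids n \<pi> S ((!) [0, x, y, z, n + 1]) ((!) [0, \<pi> x, \<pi> y, \<pi> z, n + 1])"
      using occ[unfolded 1 is_occurrence_123] by blast
    then show ?thesis
      unfolding 1 is_occurrence_123 using range[of x] range[of z]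
      by (intro exI[of _ "\<pi> x"] exI[of _ "\<pi> y"] exI[of _ "\<pi> z"]) (simp add: avoids_inv[OF \<pi>])
  next
    case 2
    obtain x y z where I: "I = {x, y, z}" "1 \<le> x" "x < y" "y < z" "z \<le> n"
      "\<pi> x < \<pi> z" "\<pi> z < \<pi> y" "avoids n \<pi> S ((!) [0, x, y, z, n + 1]) ((!) [0, \<pi> x, \<pi> z, \<pi> y, n + 1])"
      using occ[unfolded 2 is_occurrence_132] by blast
    \<comment> \<open>Sorted by value, the entries of a 132 occurrence stand at \<open>x\<close>,
      \<open>z\<close>, \<open>y\<close>; this is the order of the new positions.\<close>
    then show ?thesis
      unfolding 2 is_occurrence_132 using range[of x] range[of y]
      by (intro exI[of _ "\<pi> x"] exI[of _ "\<pi> z"] exI[of _ "\<pi> y"])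
         (simp add: avoids_inv[OF \<pi>] insert_commute)
  qed
qed

lemma Sym_inv: "\<pi> \<in> Sym n \<Longrightarrow> inv \<pi> \<in> Sym n"
  by (simp add: Sym_def permutes_inv)

lemma Sym_inv_inv: "\<pi> \<in> Sym n \<Longrightarrow> inv (inv \<pi>) = \<pi>"
  by (simp add: Sym_def permutes_inv_inv)

lemma occurrences_inv:
  assumes \<pi>: "\<pi> \<in> Sym n" and \<tau>: "\<tau> \<in> {one_line [1,2,3], one_line [1,3,2]}"
  shows "occurrences (3, \<tau>, S\<inverse>) n (inv \<pi>) = occurrences (3, \<tau>, S) n \<pi>"
proof -
  have perm: "\<pi> permutes {1..n}" using \<pi> by (simp add: Sym_def)
  have "bij_betw (image \<pi>) {I. is_occurrence n \<pi> (3, \<tau>, S) I}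
      {I. is_occurrence n (inv \<pi>) (3, \<tau>, S\<inverse>) I}"
  proof (rule bij_betw_byWitness[where f' = "image (inv \<pi>)"])
    show "image (inv \<pi>) ` {I. is_occurrence n (inv \<pi>) (3, \<tau>, S\<inverse>) I}
        \<subseteq> {I. is_occurrence n \<pi> (3, \<tau>, S) I}"
      using is_occurrence_inv[OF Sym_inv[OF \<pi>] \<tau>, of "S\<inverse>"] Sym_inv_inv[OF \<pi>] by auto
  qed (use is_occurrence_inv[OF \<pi> \<tau>] permutes_inverses[OF perm] in \<open>auto simp: image_image\<close>)
  then show ?thesis
    unfolding occurrences_def by (simp add: bij_betw_same_card)
qed

lemma jointly_equidistributed_converse:
  assumes "(3, one_line [1,2,3], S) \<sim>\<^sub>j\<^sub>d (3, one_line [1,3,2], S)"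
  shows "(3, one_line [1,2,3], S\<inverse>) \<sim>\<^sub>j\<^sub>d (3, one_line [1,3,2], S\<inverse>)"
proof -
  let ?occ = "\<lambda>n S k l. {\<pi> \<in> Sym n. occurrences (3, one_line [1,2,3], S) n \<pi> = k \<and>
    occurrences (3, one_line [1,3,2], S) n \<pi> = l}"
  have "card (?occ n S k l) = card (?occ n (S\<inverse>) k l)" for n k l
  proof -
    have occ: "occurrences (3, one_line [1,2,3], S\<inverse>) n (inv \<pi>) = occurrences (3, one_line [1,2,3], S) n \<pi>"
      "occurrences (3, one_line [1,3,2], S\<inverse>) n (inv \<pi>) = occurrences (3, one_line [1,3,2], S) n \<pi>"
      if "\<pi> \<in> Sym n" for \<pi> S
      using that by (simp_all add: occurrences_inv)
    have "bij_betw inv (?occ n S k l) (?occ n (S\<inverse>) k l)"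
    proof (rule bij_betw_byWitness[where f' = inv])
      show "inv ` ?occ n (S\<inverse>) k l \<subseteq> ?occ n S k l"
        using occ[where S = "S\<inverse>"] by (auto simp: Sym_inv)
    qed (use occ in \<open>auto simp: Sym_inv Sym_inv_inv\<close>)
    then show ?thesis by (rule bij_betw_same_card)
  qed
  then show ?thesis using assms unfolding jointly_equidistributed_def by simp
qed

section \<open>Occurrences for \<open>shading_R'\<close> as letter pairs\<close>

lemma Sym_range:
  assumes "\<pi> \<in> Sym n" "m \<in> {1..n}"
  shows "1 \<le> \<pi> m \<and> \<pi> m \<le> n"
  using assms permutes_in_image[of \<pi> "{1..n}" m] by (simp add: Sym_def)

text \<open>One statement serves both patterns: \<open>p\<close> and \<open>q\<close> are the
  positions of the middle and the largest value. Column 2 is fully shaded and forces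
  \<open>z = Suc y\<close>; the other boxes become the window and label conditions.\<close>

lemma avoids_shading_R'_iff:
  assumes \<pi>: "\<pi> \<in> Sym n" and x: "1 \<le> x" and xy: "x < y" and yz: "y < z" and z: "z \<le> n"
    and less: "\<pi> x < \<pi> p" "\<pi> p < \<pi> q" and pq: "p = y \<and> q = z \<or> p = z \<and> q = y"
  shows "avoids n \<pi> shading_R' ((!) [0, x, y, z, n + 1]) ((!) [0, \<pi> x, \<pi> p, \<pi> q, n + 1]) \<longleftrightarrow>
     z = Suc y \<and> y \<in> window n x \<pi> \<and> Suc y \<in> window n x \<pi> \<and> low n x \<pi> p \<and> high n x \<pi> q"
    (is "?L \<longleftrightarrow> ?R")
proof -
  let ?box = "\<lambda>m. \<not> (m < x \<and> \<pi> m < \<pi> x) \<and> \<not> (x < m \<and> m < y \<and> \<pi> m < \<pi> x) \<and>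
      \<not> (y < m \<and> m < z \<and> \<pi> m < \<pi> x) \<and> \<not> (m < x \<and> \<pi> q < \<pi> m) \<and>
      \<not> (y < m \<and> m < z \<and> \<pi> x < \<pi> m \<and> \<pi> m < \<pi> p) \<and>
      \<not> (y < m \<and> m < z \<and> \<pi> p < \<pi> m \<and> \<pi> m < \<pi> q) \<and>
      \<not> (y < m \<and> m < z \<and> \<pi> q < \<pi> m) \<and>
      \<not> (z < m \<and> \<pi> x < \<pi> m \<and> \<pi> m < \<pi> p) \<and> \<not> (z < m \<and> \<pi> q < \<pi> m)"
  have "?L \<longleftrightarrow> (\<forall>m\<in>{1..n}. ?box m)"
  proof -
    \<comment> \<open>The sentinel bounds always hold for entries in range and so drop out of the
      nine box conditions.\<close>
    have "0 < m \<and> m < n + 1 \<and> 0 < \<pi> m \<and> \<pi> m < n + 1" if "m \<in> {1..n}" for m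
      using that Sym_range[OF \<pi> that] by auto
    then show ?thesis
      unfolding avoids_def shading_R'_def by (simp add: ball_conj_distrib) blast
  qed
  also have "\<dots> \<longleftrightarrow> z = Suc y \<and> (\<forall>m\<in>{1..n}. ?box m)"
  proof -
    have "z = Suc y" if box: "\<forall>m\<in>{1..n}. ?box m"
    proof (rule ccontr)
      assume "z \<noteq> Suc y"
      then have m: "y < Suc y" "Suc y < z" "Suc y \<in> {1..n}" using yz z by auto
      \<comment> \<open>The value at \<open>Suc y\<close> differs from the three chosen ones, so
        this entry would fall into one of the four boxes of column 2.\<close>
      have "\<pi> (Suc y) \<noteq> \<pi> x" "\<pi> (Suc y) \<noteq> \<pi> p" "\<pi> (Suc y) \<noteq> \<pi> q"
        unfolding Sym_eq_iff[OF \<pi>] using pq m xy by auto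
      then show False using box m by (meson linorder_neqE_nat)
    qed
    then show ?thesis by blast
  qed
  \<comment> \<open>The condition on values below \<pi> x is split in two, to match the windows at
    \<open>y\<close> and at \<open>Suc y\<close>.\<close>
  also have "\<dots> \<longleftrightarrow> z = Suc y \<and> (\<forall>m\<in>{1..n}. (\<pi> m < \<pi> x \<longrightarrow> y < m) \<and> (\<pi> m < \<pi> x \<longrightarrow> Suc y < m) \<and>
      (p < m \<longrightarrow> \<not> (\<pi> x < \<pi> m \<and> \<pi> m < \<pi> p)) \<and> (\<pi> q < \<pi> m \<longrightarrow> x < m \<and> m < q))"
  proof -
    have "?box m \<longleftrightarrow> (\<pi> m < \<pi> x \<longrightarrow> y < m) \<and> (\<pi> m < \<pi> x \<longrightarrow> Suc y < m) \<and>
        (p < m \<longrightarrow> \<not> (\<pi> x < \<pi> m \<and> \<pi> m < \<pi> p)) \<and> (\<pi> q < \<pi> m \<longrightarrow> x < m \<and> m < q)"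
      if "z = Suc y" for m
    proof (cases "m = x \<or> m = y \<or> m = z")
      case True
      then show ?thesis using less pq xy that by auto
    next
      case False
      then have "m < x \<or> x < m \<and> m < y \<or> z < m" using that by auto
      then show ?thesis using pq xy that by auto
    qed
    then show ?thesis by (simp cong: conj_cong)
  qed
  also have "\<dots> \<longleftrightarrow> ?R"
    using xy yz z by (simp add: window_def low_def high_def ball_conj_distrib cong: conj_cong)
  finally show ?thesis .
qed

lemma is_occurrence_123_R':
  assumes \<pi>: "\<pi> \<in> Sym n"
  shows "is_occurrence n \<pi> (3, one_line [1,2,3], shading_R') I \<longleftrightarrow>
     (\<exists>i\<in>{1..n}. \<exists>v\<in>letter_pairs n i \<pi> Lo Hi. I = {i, v, Suc v})" (is "?L \<longleftrightarrow> ?R")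
proof
  assume ?L
  then obtain x y z where I: "I = {x, y, z}" "1 \<le> x" "x < y" "y < z" "z \<le> n" "\<pi> x < \<pi> y" "\<pi> y < \<pi> z"
    and av: "avoids n \<pi> shading_R' ((!) [0, x, y, z, n + 1]) ((!) [0, \<pi> x, \<pi> y, \<pi> z, n + 1])"
    unfolding is_occurrence_123 by blast
  have "z = Suc y \<and> y \<in> letter_pairs n x \<pi> Lo Hi"
    using av avoids_shading_R'_iff[OF \<pi> I(2-5), of y z] I by (auto simp: letter_pairs_def)
  then show ?R using I by (intro bexI[of _ x] bexI[of _ y]) auto
next
  assume ?R
  then obtain i v where iv: "i \<in> {1..n}" "v \<in> letter_pairs n i \<pi> Lo Hi" "I = {i, v, Suc v}" by blast
  have v: "v \<in> window n i \<pi>" "Suc v \<in> window n i \<pi>" "low n i \<pi> v" "high n i \<pi> (Suc v)"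
    using iv(2) by (auto simp: letter_pairs_def)
  have "avoids n \<pi> shading_R' ((!) [0, i, v, Suc v, n + 1]) ((!) [0, \<pi> i, \<pi> v, \<pi> (Suc v), n + 1])"
    using v iv(1) window_bounds[OF v(1)] window_bounds[OF v(2)]
    by (subst avoids_shading_R'_iff[OF \<pi>]) (auto intro: window_value[OF \<pi>] low_imp_less[OF \<pi>])
  then show ?L
    unfolding is_occurrence_123
    using iv v window_bounds[OF v(1)] window_bounds[OF v(2)] window_value[OF \<pi> v(1)] low_imp_less[OF \<pi> v(1-3)]
    by (intro exI[of _ i] exI[of _ v] exI[of _ "Suc v"]) simp
qed

lemma is_occurrence_132_R':
  assumes \<pi>: "\<pi> \<in> Sym n"
  shows "is_occurrence n \<pi> (3, one_line [1,3,2], shading_R') I \<longleftrightarrow>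
     (\<exists>i\<in>{1..n}. \<exists>v\<in>letter_pairs n i \<pi> Hi Lo. I = {i, v, Suc v})" (is "?L \<longleftrightarrow> ?R")
proof
  assume ?L
  then obtain x y z where I: "I = {x, y, z}" "1 \<le> x" "x < y" "y < z" "z \<le> n" "\<pi> x < \<pi> z" "\<pi> z < \<pi> y"
    and av: "avoids n \<pi> shading_R' ((!) [0, x, y, z, n + 1]) ((!) [0, \<pi> x, \<pi> z, \<pi> y, n + 1])"
    unfolding is_occurrence_132 by blast
  have "z = Suc y \<and> y \<in> letter_pairs n x \<pi> Hi Lo"
    using av avoids_shading_R'_iff[OF \<pi> I(2-5), of z y] I by (auto simp: letter_pairs_def)
  then show ?R using I by (intro bexI[of _ x] bexI[of _ y]) auto
next
  assume ?R
  then obtain i v where iv: "i \<in> {1..n}" "v \<in> letter_pairs n i \<pi> Hi Lo" "I = {i, v, Suc v}" by blast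
  have v: "v \<in> window n i \<pi>" "Suc v \<in> window n i \<pi>" "high n i \<pi> v" "low n i \<pi> (Suc v)"
    using iv(2) by (auto simp: letter_pairs_def)
  have "avoids n \<pi> shading_R' ((!) [0, i, v, Suc v, n + 1]) ((!) [0, \<pi> i, \<pi> (Suc v), \<pi> v, n + 1])"
    using v iv(1) window_bounds[OF v(1)] window_bounds[OF v(2)]
    by (subst avoids_shading_R'_iff[OF \<pi>]) (auto intro: window_value[OF \<pi>] high_imp_less[OF \<pi>])
  then show ?L
    unfolding is_occurrence_132
    using iv v window_bounds[OF v(1)] window_bounds[OF v(2)] window_value[OF \<pi> v(2)] high_imp_less[OF \<pi> v(1-3)]
    by (intro exI[of _ i] exI[of _ v] exI[of _ "Suc v"]) simp
qed

section \<open>Counting occurrences by base position\<close>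

lemma card_triples:
  "card {I. \<exists>i\<in>{1..n}. \<exists>v\<in>letter_pairs n i \<pi> a b. I = {i, v, Suc v}} =
     (\<Sum>i\<in>{1..n}. card (letter_pairs n i \<pi> a b))"
proof -
  let ?P = "SIGMA i:{1..n}. letter_pairs n i \<pi> a b"
  have fin: "finite (letter_pairs n i \<pi> a b)" for i
    by (rule finite_subset[of _ "{..n}"]) (auto simp: letter_pairs_def window_def)
  have bounds: "i < v" if "v \<in> letter_pairs n i \<pi> a b" for i v
    using that by (simp add: letter_pairs_def window_def)
  have "inj_on (\<lambda>(i, v). {i, v, Suc v}) ?P"
  proof (rule inj_onI, clarify)
    fix i v i' v'
    assume "v \<in> letter_pairs n i \<pi> a b" "v' \<in> letter_pairs n i' \<pi> a b"
      and eq: "{i, v, Suc v} = {i', v', Suc v'}"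
    then have "i < v" "i' < v'" using bounds by auto
    \<comment> \<open>The triple determines its pair: the minimum is \<open>i\<close> and the
      maximum is \<open>Suc v\<close>.\<close>
    moreover from this have "Max {i, v, Suc v} = Suc v" "Max {i', v', Suc v'} = Suc v'" by auto
    moreover from calculation have "Min {i, v, Suc v} = i" "Min {i', v', Suc v'} = i'" by auto
    ultimately show "i = i' \<and> v = v'" using eq by (metis nat.inject)
  qed
  then have "card ((\<lambda>(i, v). {i, v, Suc v}) ` ?P) = card ?P" by (rule card_image)
  moreover have "{I. \<exists>i\<in>{1..n}. \<exists>v\<in>letter_pairs n i \<pi> a b. I = {i, v, Suc v}} =
      (\<lambda>(i, v). {i, v, Suc v}) ` ?P" by auto
  ultimately show ?thesis using fin by (simp add: card_SigmaI)
qed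

lemma occurrences_R':
  assumes "\<pi> \<in> Sym n"
  shows "occurrences (3, one_line [1,2,3], shading_R') n \<pi> = (\<Sum>i\<in>{1..n}. card (letter_pairs n i \<pi> Lo Hi))"
    and "occurrences (3, one_line [1,3,2], shading_R') n \<pi> = (\<Sum>i\<in>{1..n}. card (letter_pairs n i \<pi> Hi Lo))"
  unfolding occurrences_def is_occurrence_123_R'[OF assms] is_occurrence_132_R'[OF assms] card_triples
  by simp_all

text \<open>By \<open>letter_pairs_base_unique\<close>, at most one \<open>i\<close> contributes to
  either sum. The pair \<open>(0, 0)\<close> is excluded because an \<open>i\<close> without letter
  pairs does not rule out pairs at another base.\<close>

lemma occurrences_R'_iff:
  assumes \<pi>: "\<pi> \<in> Sym n" and "(k, l) \<noteq> (0, 0)"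
  shows "occurrences (3, one_line [1,2,3], shading_R') n \<pi> = k \<and>
      occurrences (3, one_line [1,3,2], shading_R') n \<pi> = l \<longleftrightarrow>
    (\<exists>i\<in>{1..n}. card (letter_pairs n i \<pi> Lo Hi) = k \<and> card (letter_pairs n i \<pi> Hi Lo) = l)"
proof -
  let ?A = "\<lambda>i. card (letter_pairs n i \<pi> Lo Hi)" and ?B = "\<lambda>i. card (letter_pairs n i \<pi> Hi Lo)"
  have single: "(\<Sum>j\<in>{1..n}. ?A j) = ?A i" "(\<Sum>j\<in>{1..n}. ?B j) = ?B i"
    if i: "i \<in> {1..n}" "?A i \<noteq> 0 \<or> ?B i \<noteq> 0" for i
  proof -
    have "letter_pairs n i \<pi> Lo Hi \<noteq> {} \<or> letter_pairs n i \<pi> Hi Lo \<noteq> {}"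
      using i(2) by auto
    then have "letter_pairs n j \<pi> Lo Hi = {} \<and> letter_pairs n j \<pi> Hi Lo = {}" if "j \<in> {1..n}" "j \<noteq> i" for j
      using letter_pairs_base_unique[OF \<pi> that(1) i(1)] that(2) by blast
    then have "?A j = 0" "?B j = 0" if "j \<in> {1..n} - {i}" for j
      using that by simp_all
    then show "(\<Sum>j\<in>{1..n}. ?A j) = ?A i" "(\<Sum>j\<in>{1..n}. ?B j) = ?B i"
      using i(1) by (simp_all add: sum.remove[of _ i])
  qed
  show ?thesis
    unfolding occurrences_R'[OF \<pi>]
  proof
    assume sums: "(\<Sum>j\<in>{1..n}. ?A j) = k \<and> (\<Sum>j\<in>{1..n}. ?B j) = l"
    then have "(\<Sum>j\<in>{1..n}. ?A j) \<noteq> 0 \<or> (\<Sum>j\<in>{1..n}. ?B j) \<noteq> 0"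
      using assms(2) by auto
    then obtain i where "i \<in> {1..n}" "?A i \<noteq> 0 \<or> ?B i \<noteq> 0"
      by (meson sum.neutral)
    then show "\<exists>i\<in>{1..n}. ?A i = k \<and> ?B i = l"
      using sums single[of i] by (intro bexI[of _ i]) simp_all
  next
    assume "\<exists>i\<in>{1..n}. ?A i = k \<and> ?B i = l"
    then obtain i where i: "i \<in> {1..n}" "?A i = k" "?B i = l" by blast
    then have "?A i \<noteq> 0 \<or> ?B i \<noteq> 0" using assms(2) by auto
    then show "(\<Sum>j\<in>{1..n}. ?A j) = k \<and> (\<Sum>j\<in>{1..n}. ?B j) = l"
      using single[OF i(1)] i by simp
  qed
qed

text \<open>Counts other than \<open>(0, 0)\<close> force a letter pair at \<open>i\<close>, so the
  classes for different \<open>i\<close> are disjoint.\<close>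

lemma card_occurrences_R':
  assumes kl: "(k, l) \<noteq> (0, 0)"
  shows "card {\<pi> \<in> Sym n. occurrences (3, one_line [1,2,3], shading_R') n \<pi> = k \<and>
      occurrences (3, one_line [1,3,2], shading_R') n \<pi> = l} =
    (\<Sum>i\<in>{1..n}. card {\<pi> \<in> Sym n. card (letter_pairs n i \<pi> Lo Hi) = k \<and> card (letter_pairs n i \<pi> Hi Lo) = l})"
    (is "card ?X = (\<Sum>i\<in>_. card (?Y i))")
proof -
  have "?X = (\<Union>i\<in>{1..n}. ?Y i)"
    using occurrences_R'_iff[OF _ kl] by blast
  moreover have "?Y i \<inter> ?Y j = {}" if ij: "i \<in> {1..n}" "j \<in> {1..n}" "i \<noteq> j" for i j
  proof -
    have False if "\<pi> \<in> ?Y i" "\<pi> \<in> ?Y j" for \<pi>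
    proof -
      have "letter_pairs n m \<pi> Lo Hi \<noteq> {} \<or> letter_pairs n m \<pi> Hi Lo \<noteq> {}" if "\<pi> \<in> ?Y m" for m
        using that kl by auto
      then show False
        using letter_pairs_base_unique[of \<pi> n i j] that ij by blast
    qed
    then show ?thesis by blast
  qed
  ultimately show ?thesis
    by (simp add: card_UN_disjoint)
qed

lemma jointly_equidistributed_R':
  "(3, one_line [1,2,3], shading_R') \<sim>\<^sub>j\<^sub>d (3, one_line [1,3,2], shading_R')"
  unfolding jointly_equidistributed_def
proof (intro allI)
  fix n k l
  show "card {\<pi> \<in> Sym n. occurrences (3, one_line [1,2,3], shading_R') n \<pi> = k \<and>
      occurrences (3, one_line [1,3,2], shading_R') n \<pi> = l} =
    card {\<pi> \<in> Sym n. occurrences (3, one_line [1,2,3], shading_R') n \<pi> = l \<and>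
      occurrences (3, one_line [1,3,2], shading_R') n \<pi> = k}"
  proof (cases "(k, l) = (0, 0)")
    case True
    then have "k = l" by simp
    then show ?thesis by (simp only:)
  next
    case False
    then have "(l, k) \<noteq> (0, 0)" by auto
    show ?thesis
      unfolding card_occurrences_R'[OF False] card_occurrences_R'[OF \<open>(l, k) \<noteq> (0, 0)\<close>]
      by (intro sum.cong refl card_pairs_swap)
  qed
qed

theorem theorem3p4:
  shows "(3, one_line [1,2,3], shading_R) \<sim>\<^sub>j\<^sub>d (3, one_line [1,3,2], shading_R) \<and>
         (3, one_line [1,2,3], shading_R') \<sim>\<^sub>j\<^sub>d (3, one_line [1,3,2], shading_R')"
proof -
  have "shading_R = shading_R'\<inverse>"
    by (auto simp: shading_R_def shading_R'_def)
  then show ?thesis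
    using jointly_equidistributed_R' jointly_equidistributed_converse[OF jointly_equidistributed_R'] by simp
qed

end
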